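(* Let $(r_n)_{n\ge 0}$ be the Golay-Rudin-Shapiro sequence, $R_N(z)=\sum_{n=0}^{N} r_n z^n$ for $N\ge 1$, and let $\widetilde R_N = R_N/\|R_N\|_2$ be its $L^2$-normalization. Then $\limsup_{N\to\infty}\|\widetilde R_N\|_1<1$, and for every real $\alpha\ge 0$ the sequence $(\widetilde R_N)_{N\ge1}$ is not $L^\alpha$-flat.
   Context: $S^1$ is the unit circle in $\mathbb{C}$ and $dz$ denotes normalized Lebesgue measure on $S^1$. The Rudin-Shapiro polynomials $P_n, Q_n$ are defined by $P_0=Q_0=1$, $P_{n+1}(z)=P_n(z)+z^{2^n}Q_n(z)$, $Q_{n+1}(z)=P_n(z)-z^{2^n}Q_n(z)$ for $n\ge0$. The Golay-Rudin-Shapiro sequence $(r_k)_{k\ge0}$ is the $\pm1$ sequence such that $P_n(z)=\sum_{k=0}^{2^n-1}r_kz^k$ for all $n$; equivalently $r_k=(-1)^{s(k)}$, where $s(k)$ is the number of (possibly overlapping) occurrences of the block $11$ in the binary expansion of $k$. For $\alpha>0$, $\|f\|_\alpha = \left(\int_{S^1}|f|^\alpha\,dz\right)^{1/\alpha}$, and $\|f\|_0=M(f)=\exp\left(\int_{S^1}\log|f|\,dz\right)$ is the Mahler measure. A sequence $(p_N)$ of analytic trigonometric polynomials with $\|p_N\|_2=1$ is called $L^\alpha$-flat, for $\alpha>0$, if $\big\||p_N|-1\big\|_\alpha\to 0$ as $N\to\infty$; it is called $L^0$-flat if $M(p_N)\to 1$. *)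

theory Defs
  imports "HOL-Analysis.Analysis" "HOL-Computational_Algebra.Polynomial"
begin

fun RS_P :: "nat \<Rightarrow> complex poly" and RS_Q :: "nat \<Rightarrow> complex poly" where
  "RS_P 0 = 1"
| "RS_Q 0 = 1"
| "RS_P (Suc n) = RS_P n + monom 1 (2 ^ n) * RS_Q n"
| "RS_Q (Suc n) = RS_P n - monom 1 (2 ^ n) * RS_Q n"

definition GRS :: "nat \<Rightarrow> int" where
  "GRS = (THE r. \<forall>n. RS_P n = (\<Sum>k<2 ^ n. monom (of_int (r k)) k))"

definition block11_count :: "nat \<Rightarrow> nat" where
  "block11_count k = card {i. bit k i \<and> bit k (Suc i)}"

text \<open>Exactly one sequence satisfies the description defining \<^const>\<open>GRS\<close>; its closed form
  in terms of (possibly overlapping) binary blocks 11 is \<open>GRS_eq_block11\<close> below.\<close>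

lemma not_bit_above:
  fixes k :: nat
  assumes "k < 2 ^ m" "m \<le> j"
  shows "\<not> bit k j"
proof -
  have "(2::nat) ^ m \<le> 2 ^ j" using assms(2) by (intro power_increasing) auto
  with assms(1) have "k div 2 ^ j = 0" by (intro div_less) linarith
  then show ?thesis by (simp add: bit_iff_odd)
qed

lemma bit_power_add:
  fixes k :: nat
  assumes "k < 2 ^ m"
  shows "bit (2 ^ m + k) i \<longleftrightarrow> i = m \<or> bit k i"
proof -
  have nb: "\<not> bit k j" if "j \<ge> m" for j
    using not_bit_above[OF assms that] .
  have "2 ^ m + k = or (2 ^ m) k"
    by (rule disjunctive_add_eq_or) (rule bit_eqI, auto simp: bit_and_iff bit_exp_iff nb)
  then show ?thesis by (auto simp: bit_or_iff bit_exp_iff)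
qed

lemma finite_block11: "finite {i. bit (k::nat) i \<and> bit k (Suc i)}"
proof (rule finite_subset)
  show "{i. bit k i \<and> bit k (Suc i)} \<subseteq> {..<k}"
  proof clarsimp
    fix i assume "bit k i"
    show "i < k"
    proof (rule ccontr)
      assume "\<not> i < k"
      then have "k < 2 ^ i" using less_exp[of i] by linarith
      with \<open>bit k i\<close> show False using not_bit_above[of k i i] by blast
    qed
  qed
qed simp

lemma block11_count_power_add:
  assumes "k < 2 ^ Suc n"
  shows "block11_count (2 ^ Suc n + k) = block11_count k + (if bit k n then 1 else 0)"
proof -
  have nb: "\<not> bit k (Suc n)" "\<not> bit k (Suc (Suc n))"
    by (rule not_bit_above[OF assms], simp)+
  have eq: "{i. bit (2 ^ Suc n + k) i \<and> bit (2 ^ Suc n + k) (Suc i)}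
      = {i. bit k i \<and> bit k (Suc i)} \<union> (if bit k n then {n} else {})"
    unfolding bit_power_add[OF assms] using nb by auto
  have "n \<notin> {i. bit k i \<and> bit k (Suc i)}" using nb by simp
  then show ?thesis
    unfolding block11_count_def eq using finite_block11[of k] by simp
qed

lemma sum_monom_double:
  fixes f :: "nat \<Rightarrow> complex"
  shows "(\<Sum>k<2 ^ Suc n. monom (f k) k)
    = (\<Sum>k<2 ^ n. monom (f k) k) + monom 1 (2 ^ n) * (\<Sum>k<2 ^ n. monom (f (2 ^ n + k)) k)"
proof -
  have "(\<Sum>k<2 ^ n + 2 ^ n. monom (f k) k)
      = (\<Sum>k<2 ^ n. monom (f k) k) + (\<Sum>k<2 ^ n. monom (f (2 ^ n + k)) (2 ^ n + k))"
    using sum.atLeastLessThan_concat[of 0 "2^n" "2^n+2^n" "\<lambda>k. monom (f k) k"]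
      sum.shift_bounds_nat_ivl[of "\<lambda>k. monom (f k) k" 0 "2^n" "2^n"]
    by (simp add: lessThan_atLeast0 add.commute)
  then show ?thesis by (simp add: sum_distrib_left mult_monom mult_2)
qed

lemma RS_P_RS_Q_block11:
  "RS_P n = (\<Sum>k<2 ^ n. monom (of_int ((-1) ^ block11_count k)) k) \<and>
   RS_Q n = (\<Sum>k<2 ^ n. monom (of_int ((-1) ^ block11_count (2 ^ n + k))) k)"
proof (induction n)
  case 0
  have "block11_count 0 = 0" "block11_count 1 = 0"
    by (auto simp: block11_count_def)
  then show ?case by simp
next
  case (Suc n)
  let ?b = "\<lambda>k. of_int ((-1) ^ block11_count k) :: complex"
  have lo: "?b (2 ^ Suc n + k) = ?b k" if "k < 2 ^ n" for k
  proof -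
    have "\<not> bit k n"
      by (rule not_bit_above[OF that order_refl])
    moreover have "k < 2 ^ Suc n" using that by simp
    ultimately show ?thesis by (simp only: block11_count_power_add if_False add_0_right)
  qed
  have hi: "?b (2 ^ Suc n + (2 ^ n + k)) = - ?b (2 ^ n + k)" if "k < 2 ^ n" for k
  proof -
    have "2 ^ n + k < 2 ^ Suc n" using that by simp
    moreover have "bit (2 ^ n + k) n" using bit_power_add[OF that] by simp
    ultimately show ?thesis
      by (simp only: block11_count_power_add if_True power_add power_one_right of_int_mult
          of_int_minus of_int_1 mult_minus_right mult_1_right)
  qed
  have neg: "(\<Sum>k<2 ^ n. monom (- ?b (2 ^ n + k)) k) = - (\<Sum>k<2 ^ n. monom (?b (2 ^ n + k)) k)"
    by (simp only: sum_negf minus_monom[symmetric])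
  have "(\<Sum>k<2 ^ Suc n. monom (?b (2 ^ Suc n + k)) k)
      = (\<Sum>k<2 ^ n. monom (?b k) k) + monom 1 (2 ^ n) * (\<Sum>k<2 ^ n. monom (- ?b (2 ^ n + k)) k)"
    unfolding sum_monom_double
    by (intro arg_cong2[of _ _ _ _ "(+)"] arg_cong2[of _ _ _ _ "(*)"] refl sum.cong
        arg_cong2[of _ _ _ _ monom] lo hi) auto
  also have "\<dots> = RS_P n - monom 1 (2 ^ n) * RS_Q n"
    by (simp only: neg conjunct1[OF Suc.IH] conjunct2[OF Suc.IH] mult_minus_right diff_conv_add_uminus)
  finally have "RS_Q (Suc n) = (\<Sum>k<2 ^ Suc n. monom (?b (2 ^ Suc n + k)) k)"
    by (simp only: RS_Q.simps)
  moreover have "RS_P (Suc n) = (\<Sum>k<2 ^ Suc n. monom (?b k) k)"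
    by (simp only: sum_monom_double[of ?b n] RS_P.simps conjunct1[OF Suc.IH] conjunct2[OF Suc.IH])
  ultimately show ?case by (rule conjI[rotated])
qed

lemma GRS_unique:
  assumes "\<And>n. RS_P n = (\<Sum>k<2 ^ n. monom (of_int (r k)) k)"
  shows "r = (\<lambda>k. (-1) ^ block11_count k)"
proof
  fix k :: nat
  have "k < 2 ^ k" by simp
  then have c: "coeff (\<Sum>j<2 ^ k. monom (of_int (f j) :: complex) j) k = of_int (f k)" for f
    by (simp add: coeff_sum)
  have "of_int (r k) = (of_int ((-1) ^ block11_count k) :: complex)"
    using c[of r] c[of "\<lambda>k. (-1) ^ block11_count k"]
    unfolding assms[of k, symmetric] conjunct1[OF RS_P_RS_Q_block11[of k], symmetric] by (rule trans[OF sym])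
  then show "r k = (-1) ^ block11_count k" by (simp only: of_int_eq_iff)
qed

lemma GRS_eq_block11: "GRS k = (-1) ^ block11_count k"
proof -
  have "GRS = (\<lambda>k. (-1) ^ block11_count k)"
    unfolding GRS_def
  proof (rule the_equality)
    show "\<forall>n. RS_P n = (\<Sum>k<2 ^ n. monom (of_int ((-1) ^ block11_count k)) k)"
      by (intro allI conjunct1[OF RS_P_RS_Q_block11])
  qed (rule GRS_unique, erule spec)
  then show ?thesis by (rule fun_cong)
qed

lemma RS_P_eq_GRS: "RS_P n = (\<Sum>k<2 ^ n. monom (of_int (GRS k)) k)"
  unfolding GRS_eq_block11 by (rule conjunct1[OF RS_P_RS_Q_block11])

definition circle_measure :: "complex measure" where
  "circle_measure =
     distr (uniform_measure lborel {0..2 * pi}) (restrict_space borel (sphere 0 1)) cis"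

lemma cis_measurable_circle:
  "cis \<in> measurable (uniform_measure lborel {0..2 * pi}) (restrict_space borel (sphere 0 1))"
proof (rule measurable_restrict_space2)
  have "cis \<in> borel_measurable borel"
    by (intro borel_measurable_continuous_onI continuous_intros)
  then show "cis \<in> borel_measurable (uniform_measure lborel {0..2 * pi})"
    by (simp add: measurable_def)
qed simp

lemma emeasure_circle_measure: "emeasure circle_measure (sphere 0 1) = 1"
proof -
  have "emeasure circle_measure (sphere 0 1) = emeasure (uniform_measure lborel {0..2 * pi}) UNIV"
    unfolding circle_measure_def
    by (subst emeasure_distr[OF cis_measurable_circle]) (auto simp: sets_restrict_space vimage_def)
  also have "\<dots> = 1"
    using pi_gt_zero by (simp add: divide_ennreal)
  finally show ?thesis .
qed

text \<open>Only meant for functions with integrable log-modulus (such as nonzero polynomials):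
  the library has \<^term>\<open>ln (0::real) = 0\<close>, and the integral of a non-integrable function is 0.\<close>

definition Mahler :: "(complex \<Rightarrow> complex) \<Rightarrow> real" where
  "Mahler f = exp (LINT z|circle_measure. ln (cmod (f z)))"

definition circle_norm :: "real \<Rightarrow> (complex \<Rightarrow> complex) \<Rightarrow> real" where
  "circle_norm \<alpha> f =
     (if \<alpha> = 0 then Mahler f
      else (LINT z|circle_measure. cmod (f z) powr \<alpha>) powr (1 / \<alpha>))"

definition L_flat :: "real \<Rightarrow> (nat \<Rightarrow> complex \<Rightarrow> complex) \<Rightarrow> bool" where
  "L_flat \<alpha> p \<longleftrightarrow>
     (if \<alpha> = 0 then (\<lambda>N. Mahler (p N)) \<longlonglongrightarrow> 1
      else (\<lambda>N. circle_norm \<alpha> (\<lambda>z. complex_of_real (cmod (p N z) - 1))) \<longlonglongrightarrow> 0)"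

definition GRS_poly :: "nat \<Rightarrow> complex poly" where
  "GRS_poly N = (\<Sum>n\<le>N. monom (of_int (GRS n)) n)"

definition GRS_normalized :: "nat \<Rightarrow> complex \<Rightarrow> complex" where
  "GRS_normalized N z =
     poly (GRS_poly N) z / complex_of_real (circle_norm 2 (poly (GRS_poly N)))"

end

theory Submission
  imports Defs "HOL-Computational_Algebra.Fundamental_Theorem_Algebra"
begin

text \<open>Let \<open>S m\<close> be the sum of the first \<open>m\<close> terms \<open>r\<^sub>n z\<^sup>n\<close>. The recursion \<open>r\<^sub>2\<^sub>n = r\<^sub>n\<close>,
  \<open>r\<^sub>2\<^sub>n\<^sub>+\<^sub>1 = (-1)\<^sup>n r\<^sub>n\<close> gives \<open>S (2m) z = S m (z\<^sup>2) + z S m (-z\<^sup>2)\<close>. Used twice, it expresses the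
  values of \<open>S (4m)\<close> at the eight points \<open>\<omega>y\<close> with \<open>\<omega>\<^sup>8 = 1\<close> as explicit linear combinations of
  only two complex numbers, \<open>a = S m (y\<^sup>4)\<close> and \<open>b = S m (-y\<^sup>4)\<close>. The heart of the proof is that no
  choice of \<open>a\<close> and \<open>b\<close> brings the moduli of all eight combinations near 1, unless \<open>y\<close> lies
  near one of finitely many degenerate directions (lemma \<open>not_near_flat_at_eight_points\<close>).
  One of \<open>y\<close> and \<open>cis (pi/16) y\<close> always avoids these directions. Hence among the 32 rotations
  of any point of the circle by powers of \<open>cis (pi/16)\<close> there is one at which the
  normalized modulus \<open>|S (4m)| / s\<close> differs from 1 by a fixed amount, and passing from \<open>4m\<close> to any
  number of terms changes this only by a bounded amount divided by the large \<open>s\<close>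
  (lemma \<open>GRS_sum_not_flat\<close>).

  Because the measure of the circle is invariant under rotation, this pointwise fact integrates to a
  positive lower bound, uniform in all large \<open>N\<close>, for the integral of \<open>| |p\<^sub>N| - 1 |\<^sup>\<alpha>\<close>, for every
  \<open>\<alpha> > 0\<close> (lemma \<open>GRS_normalized_deviation\<close>). So \<open>p\<^sub>N\<close> is not flat for \<open>\<alpha> > 0\<close>. For \<open>\<alpha> = 2\<close>, the integral is
  \<open>2 - 2 \<parallel>p\<^sub>N\<parallel>\<^sub>1\<close>, which bounds the \<open>L\<^sup>1\<close> norms away from 1. Finally \<open>ln x \<le> x - 1\<close> gives
  \<open>M (p\<^sub>N) \<le> exp (\<parallel>p\<^sub>N\<parallel>\<^sub>1 - 1)\<close>, which settles \<open>\<alpha> = 0\<close>; here the integrability of \<open>ln |p\<^sub>N|\<close> is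
  essential, since the Lebesgue integral of a non-integrable function is 0 by convention.\<close>

section \<open>No near-flatness at eight points\<close>

text \<open>Knowing \<open>h\<close> to be nearly orthogonal to \<open>y\<close> and nearly parallel to \<open>cnj y\<close> forces \<open>h\<close> to be nearly 0,
  unless these two real lines through the origin coincide, which happens exactly for \<open>Re (y\<^sup>2) = 0\<close>.
  The identity is Cramer's rule for the two real equations; the bound after it is used with three
  different pairs \<open>(y, h)\<close>.\<close>

lemma orthogonal_parallel_identity:
  fixes y h :: complex
  shows "h * Re (y\<^sup>2) = cnj y * Re (cnj y * h) + \<i> * y * Im (y * h)"
  by (simp add: complex_eq_iff power2_eq_square algebra_simps)

lemma orthogonal_parallel_bound:
  fixes y h :: complex
  assumes "cmod y = 1"
  shows "cmod h * \<bar>Re (y\<^sup>2)\<bar> \<le> \<bar>Re (cnj y * h)\<bar> + \<bar>Im (y * h)\<bar>"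
proof -
  have "cmod h * \<bar>Re (y\<^sup>2)\<bar> = cmod (h * Re (y\<^sup>2))"
    by (simp only: norm_mult norm_of_real)
  also have "\<dots> = cmod (cnj y * Re (cnj y * h) + \<i> * y * Im (y * h))"
    by (simp only: orthogonal_parallel_identity)
  also have "\<dots> \<le> cmod (cnj y * Re (cnj y * h)) + cmod (\<i> * y * Im (y * h))"
    by (rule norm_triangle_ineq)
  also have "\<dots> = \<bar>Re (cnj y * h)\<bar> + \<bar>Im (y * h)\<bar>"
    using assms by (simp only: norm_mult norm_of_real complex_mod_cnj norm_ii mult_1)
  finally show ?thesis .
qed

lemma cmod_sq_add_mult:
  fixes y u v :: complex
  assumes "cmod y = 1"
  shows "(cmod (u + y * v))\<^sup>2 = (cmod u)\<^sup>2 + (cmod v)\<^sup>2 + 2 * Re (cnj y * (u * cnj v))"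
    and "(cmod (u - y * v))\<^sup>2 = (cmod u)\<^sup>2 + (cmod v)\<^sup>2 - 2 * Re (cnj y * (u * cnj v))"
proof -
  have a: "(cmod (y * v))\<^sup>2 = (cmod v)\<^sup>2" using assms by (simp add: norm_mult)
  have b: "u * cnj (y * v) = cnj y * (u * cnj v)" by simp
  have c: "(cmod (u + w))\<^sup>2 = (cmod u)\<^sup>2 + (cmod w)\<^sup>2 + 2 * Re (u * cnj w)"
    and d: "(cmod (u - w))\<^sup>2 = (cmod u)\<^sup>2 + (cmod w)\<^sup>2 - 2 * Re (u * cnj w)" for w
    by (simp_all only: cmod_power2) (simp_all add: power2_eq_square algebra_simps)
  show "(cmod (u + y * v))\<^sup>2 = (cmod u)\<^sup>2 + (cmod v)\<^sup>2 + 2 * Re (cnj y * (u * cnj v))"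
    by (simp only: c a b)
  show "(cmod (u - y * v))\<^sup>2 = (cmod u)\<^sup>2 + (cmod v)\<^sup>2 - 2 * Re (cnj y * (u * cnj v))"
    by (simp only: d a b)
qed

text \<open>The value 1/100 is a convenience: the argument below reaches a contradiction for any sufficiently
  small tolerance.\<close>

definition near_unit :: "complex \<Rightarrow> bool" where
  "near_unit x \<longleftrightarrow> \<bar>(cmod x)\<^sup>2 - 1\<bar> < 1 / 100"

text \<open>The sum and the difference of the squared moduli of \<open>u + yv\<close> and \<open>u - yv\<close> give \<open>|u|\<^sup>2 + |v|\<^sup>2\<close> and
  \<open>Re (cnj y h)\<close> for \<open>h = u cnj v\<close>. The other two points give \<open>Im (y h)\<close> in the same way, so the two
  conditions on \<open>h\<close> hold: away from the directions
  with \<open>Re (y\<^sup>2) = 0\<close>, flatness at four points forces \<open>u\<close> or \<open>v\<close> to be small.\<close>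

lemma near_flat_imp_product_small:
  fixes y u v :: complex
  assumes y: "cmod y = 1"
    and n: "near_unit (u + y * v)" "near_unit (u - y * v)"
      "near_unit (v + \<i> * y * u)" "near_unit (v - \<i> * y * u)"
  shows "cmod (u * cnj v) * \<bar>Re (y\<^sup>2)\<bar> \<le> 1 / 100" "(cmod u)\<^sup>2 + (cmod v)\<^sup>2 > 99 / 100"
proof -
  have y2: "cmod (\<i> * y) = 1" using y by (simp add: norm_mult)
  have "\<bar>Re (cnj y * (u * cnj v))\<bar> \<le> 1/200"
    using n(1,2) cmod_sq_add_mult[OF y, of u v] unfolding near_unit_def by linarith
  moreover have "\<bar>Re (cnj (\<i> * y) * (v * cnj u))\<bar> \<le> 1/200"
    using n(3,4) cmod_sq_add_mult[OF y2, of v u] unfolding near_unit_def by linarith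
  moreover have "Re (cnj (\<i> * y) * (v * cnj u)) = - Im (y * (u * cnj v))"
    by (simp add: algebra_simps)
  ultimately show "cmod (u * cnj v) * \<bar>Re (y\<^sup>2)\<bar> \<le> 1 / 100"
    using orthogonal_parallel_bound[OF y, of "u * cnj v"] by linarith
  show "(cmod u)\<^sup>2 + (cmod v)\<^sup>2 > 99 / 100"
    using n(1,2) cmod_sq_add_mult[OF y, of u v] unfolding near_unit_def by linarith
qed

text \<open>One level down, smallness of the product \<open>u cnj v\<close> again splits into two conditions: \<open>a\<close> and \<open>b\<close> have
  nearly equal modulus, and \<open>e cnj a b\<close> is nearly real.\<close>

lemma mult_cnj_add_diff:
  fixes e a b :: complex
  assumes e: "cmod e = 1"
  shows "(a + e * b) * cnj (a - e * b) = complex_of_real ((cmod a)\<^sup>2 - (cmod b)\<^sup>2) + 2 * \<i> * Im (e * (cnj a * b))"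
proof -
  have "(cmod (e*b))\<^sup>2 = (cmod b)\<^sup>2" using e by (simp add: norm_mult)
  then have "complex_of_real ((cmod a)\<^sup>2 - (cmod b)\<^sup>2) = complex_of_real ((cmod a)\<^sup>2) - complex_of_real ((cmod (e * b))\<^sup>2)"
    by simp
  then have "complex_of_real ((cmod a)\<^sup>2 - (cmod b)\<^sup>2) = a * cnj a - (e*b) * cnj (e*b)"
    by (simp only: complex_norm_square)
  then show ?thesis by (simp add: complex_eq_iff algebra_simps)
qed

lemma le_of_mult_le_of_sq_ge:
  assumes "(h::real) * r \<le> 1/100" "r\<^sup>2 \<ge> 1/32" "h \<ge> 0" "r \<ge> 0"
  shows "h \<le> 6 / 100"
proof -
  have "(1/6)\<^sup>2 \<le> r\<^sup>2" using assms(2) by (simp add: power2_eq_square)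
  then have "1/6 \<le> r" using assms(4) by (rule power2_le_imp_le)
  then have "h * (1/6) \<le> h * r" using assms by (intro mult_left_mono) auto
  then show ?thesis using assms(1) by simp
qed

lemma bounds_of_logistic_ge_half:
  fixes x :: real
  assumes "4 * x * (1 - x) \<ge> 1 / 2" "0 \<le> x" "x \<le> 1"
  shows "x \<ge> 1/8" "x \<le> 7/8"
proof -
  show "x \<ge> 1/8"
  proof (rule ccontr)
    assume "\<not> ?thesis"
    then have "4 * x * (1 - x) \<le> 4 * x * 1" using assms by (intro mult_left_mono) auto
    then show False using assms \<open>\<not> x \<ge> 1/8\<close> by linarith
  qed
  show "x \<le> 7/8"
  proof (rule ccontr)
    assume "\<not> ?thesis"
    then have "4 * x * (1 - x) \<le> 4 * (1 - x)" using assms by (intro mult_right_mono) auto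
    then show False using assms \<open>\<not> x \<le> 7/8\<close> by argo
  qed
qed

text \<open>The bound of \<open>orthogonal_parallel_bound\<close> is applied with determinants \<open>Re e\<close>, \<open>- Im e\<close> and \<open>Re (e\<^sup>2)\<close>. All three
  stay away from 0 when \<open>Re (e\<^sup>8) \<le> 0\<close>, since \<open>e\<^sup>8 = 1\<close> wherever one of them vanishes.\<close>

lemma determinants_away_from_zero:
  fixes e :: complex
  assumes e: "cmod e = 1" and g: "Re (e ^ 8) \<le> 0"
  shows "(Re e)\<^sup>2 \<ge> 1/32" "(Im e)\<^sup>2 \<ge> 1/32" "(Re (e\<^sup>2))\<^sup>2 \<ge> 1/8"
proof -
  have one: "(Re z)\<^sup>2 + (Im z)\<^sup>2 = 1" if "cmod z = 1" for z
    using that cmod_power2[of z] by simp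
  have dbl: "Re (z\<^sup>2) = 2 * (Re z)\<^sup>2 - 1" if "cmod z = 1" for z
    using one[OF that] by (simp add: power2_eq_square)
  define z where "z = e\<^sup>2"
  have z: "cmod z = 1" by (simp add: z_def norm_power e)
  have z2: "cmod (z\<^sup>2) = 1" by (simp add: z norm_power)
  have "e ^ 8 = (z\<^sup>2)\<^sup>2" by (simp add: z_def flip: power_mult)
  then have "2 * (2 * (Re z)\<^sup>2 - 1)\<^sup>2 - 1 \<le> 0" using g dbl[OF z] dbl[OF z2] by simp
  then have "4 * (Re z)\<^sup>2 * (1 - (Re z)\<^sup>2) \<ge> 1/2" by (simp add: power2_eq_square algebra_simps)
  moreover have "(Re z)\<^sup>2 \<le> 1" using one[OF z] by (smt (verit) zero_le_power2)
  ultimately have b: "(Re z)\<^sup>2 \<ge> 1/8" "(Re z)\<^sup>2 \<le> 7/8" using bounds_of_logistic_ge_half[of "(Re z)\<^sup>2"] by auto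
  then show "(Re (e\<^sup>2))\<^sup>2 \<ge> 1/8" by (simp add: z_def)
  have "(Re z)\<^sup>2 \<le> (15/16)\<^sup>2" using b by (simp add: power2_eq_square)
  then have "\<bar>Re z\<bar> \<le> 15/16" using power2_le_iff_abs_le[of "15/16" "Re z"] by simp
  moreover have "Re z = 2 * (Re e)\<^sup>2 - 1" using dbl[OF e] by (simp add: z_def)
  ultimately show "(Re e)\<^sup>2 \<ge> 1/32" "(Im e)\<^sup>2 \<ge> 1/32" using one[OF e] by linarith+
qed

text \<open>The arguments are the values of the longer sum at \<open>y\<close>, \<open>-y\<close>, \<open>\<i>y\<close>, \<open>-\<i>y\<close>, when \<open>u\<close> and \<open>v\<close> are the values
  of the half-length sum at \<open>y\<^sup>2\<close> and \<open>-y\<^sup>2\<close>.\<close>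

definition near_flat4 where
  "near_flat4 y u v \<longleftrightarrow> near_unit (u + y * v) \<and> near_unit (u - y * v) \<and>
      near_unit (v + \<i> * y * u) \<and> near_unit (v - \<i> * y * u)"

text \<open>Flatness at \<open>y\<close> and its rotations by fourth roots of unity makes \<open>a\<close> and \<open>b\<close> nearly equal in
  modulus and \<open>e cnj a b\<close> nearly real; flatness at the rotations of \<open>k y\<close>, with \<open>k\<close> a primitive eighth
  root of unity, makes \<open>e a cnj b\<close> nearly imaginary. For \<open>T = cnj a b\<close> these are again two conditions,
  now with determinant \<open>Re (e\<^sup>2)\<close>, so \<open>T\<close> is small. But \<open>|a|\<close> and \<open>|b|\<close> are nearly equal and
  \<open>|a|\<^sup>2 + |b|\<^sup>2\<close> is about 1/2, so \<open>|T|\<close> is about 1/4.\<close>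

lemma not_near_flat_at_eight_points:
  fixes y a b k :: complex
  assumes y: "cmod y = 1" and k: "k\<^sup>2 = \<i>" and g: "Re (y ^ 16) \<le> 0"
  defines "e \<equiv> y\<^sup>2"
  assumes n1: "near_flat4 y (a + e * b) (a - e * b)"
    and n2: "near_flat4 (k * y) (b + \<i> * e * a) (b - \<i> * e * a)"
  shows False
proof -
  have e: "cmod e = 1" "cmod (\<i> * e) = 1" by (simp_all add: e_def norm_mult norm_power y)
  have "cmod k ^ 2 = 1" using k by (metis norm_ii norm_power)
  then have "cmod k = 1" by (simp add: power2_eq_1_iff) (smt (verit) norm_ge_zero)
  then have ky: "cmod (k * y) = 1" by (simp add: norm_mult y)
  have "e ^ 8 = y ^ 16" by (simp add: e_def flip: power_mult)
  then have ang: "(Re e)\<^sup>2 \<ge> 1/32" "(Im e)\<^sup>2 \<ge> 1/32" "(Re (e\<^sup>2))\<^sup>2 \<ge> 1/8"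
    using determinants_away_from_zero[OF e(1)] g by auto
  define h where "h = (a + e * b) * cnj (a - e * b)"
  define h' where "h' = (b + \<i> * e * a) * cnj (b - \<i> * e * a)"
  define T where "T = cnj a * b"
  have "cmod h * \<bar>Re e\<bar> \<le> 1/100"
    using near_flat_imp_product_small(1)[OF y, of "a + e * b" "a - e * b"] n1 by (simp add: near_flat4_def e_def h_def)
  then have hb: "cmod h \<le> 6/100" by (rule le_of_mult_le_of_sq_ge) (use ang in auto)
  have "(k * y)\<^sup>2 = \<i> * e" by (simp add: power_mult_distrib k e_def)
  then have "cmod h' * \<bar>Im e\<bar> \<le> 1/100"
    using near_flat_imp_product_small(1)[OF ky, of "b + \<i> * e * a" "b - \<i> * e * a"] n2 by (simp add: near_flat4_def h'_def)
  then have hb': "cmod h' \<le> 6/100" by (rule le_of_mult_le_of_sq_ge) (use ang in auto)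
  have h: "Re h = (cmod a)\<^sup>2 - (cmod b)\<^sup>2" "Im h = 2 * Im (e * T)"
    unfolding h_def mult_cnj_add_diff[OF e(1)] T_def by simp_all
  have "Im h' = 2 * Im (\<i> * e * (cnj b * a))"
    unfolding h'_def mult_cnj_add_diff[OF e(2)] by simp
  then have h': "Im h' = 2 * Re (cnj e * T)" by (simp add: T_def algebra_simps)
  have "\<bar>Im (e * T)\<bar> \<le> 3/100" using abs_Im_le_cmod[of h] hb h by linarith
  moreover have "\<bar>Re (cnj e * T)\<bar> \<le> 3/100" using abs_Im_le_cmod[of h'] hb' h' by linarith
  ultimately have T: "cmod T * \<bar>Re (e\<^sup>2)\<bar> \<le> 6/100"
    using orthogonal_parallel_bound[OF e(1), of T] by linarith
  have "(1/3)\<^sup>2 \<le> \<bar>Re (e\<^sup>2)\<bar>\<^sup>2" using ang(3) by (simp add: power2_eq_square)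
  then have "1/3 \<le> \<bar>Re (e\<^sup>2)\<bar>" by (rule power2_le_imp_le) simp
  then have "cmod T * (1/3) \<le> cmod T * \<bar>Re (e\<^sup>2)\<bar>" by (intro mult_left_mono) auto
  then have T: "cmod T \<le> 18/100" using T by linarith
  then have T2: "(cmod T)\<^sup>2 \<le> (18/100)\<^sup>2" by (intro power_mono) auto
  have "(cmod (a + e * b))\<^sup>2 + (cmod (a - e * b))\<^sup>2 > 99/100"
    using near_flat_imp_product_small(2)[OF y, of "a + e * b" "a - e * b"] n1 by (simp add: near_flat4_def e_def)
  then have S: "(cmod a)\<^sup>2 + (cmod b)\<^sup>2 > 99/200"
    using cmod_sq_add_mult[OF e(1), of a b] by linarith
  then have S2: "((cmod a)\<^sup>2 + (cmod b)\<^sup>2)\<^sup>2 \<ge> (99/200)\<^sup>2"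
    by (intro power_mono) auto
  have "\<bar>(cmod a)\<^sup>2 - (cmod b)\<^sup>2\<bar> \<le> 6/100" using abs_Re_le_cmod[of h] hb h by linarith
  then have D2: "((cmod a)\<^sup>2 - (cmod b)\<^sup>2)\<^sup>2 \<le> (6/100)\<^sup>2" using power2_le_iff_abs_le[of "6/100::real"] by simp
  have "(cmod T)\<^sup>2 = (cmod a)\<^sup>2 * (cmod b)\<^sup>2" by (simp add: T_def norm_mult power_mult_distrib)
  then have "4 * (cmod T)\<^sup>2 = ((cmod a)\<^sup>2 + (cmod b)\<^sup>2)\<^sup>2 - ((cmod a)\<^sup>2 - (cmod b)\<^sup>2)\<^sup>2"
    by (simp add: power2_eq_square algebra_simps)
  then show False using T2 S2 D2 by (simp add: power2_eq_square)
qed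

section \<open>Self-similarity of the Golay-Rudin-Shapiro sums\<close>

lemma block11_count_double: "block11_count (2 * n) = block11_count n"
proof -
  have "{i. bit (2 * n) i \<and> bit (2 * n) (Suc i)} = Suc ` {i. bit n i \<and> bit n (Suc i)}"
  proof (intro set_eqI)
    fix i show "i \<in> {i. bit (2 * n) i \<and> bit (2 * n) (Suc i)} \<longleftrightarrow> i \<in> Suc ` {i. bit n i \<and> bit n (Suc i)}"
      by (cases i) (auto simp: bit_double_iff)
  qed
  then show ?thesis by (simp add: block11_count_def card_image)
qed

lemma block11_count_double_Suc:
  "block11_count (Suc (2 * n)) = block11_count n + (if odd n then 1 else 0)"
proof -
  have b: "bit (Suc (2 * n)) i \<longleftrightarrow> i = 0 \<or> bit n (i - 1)" for i
    by (cases i) (simp_all add: bit_Suc bit_0)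
  have "{i. bit (Suc (2 * n)) i \<and> bit (Suc (2 * n)) (Suc i)}
      = Suc ` {i. bit n i \<and> bit n (Suc i)} \<union> (if odd n then {0} else {})"
  proof (intro set_eqI)
    fix i show "i \<in> {i. bit (Suc (2 * n)) i \<and> bit (Suc (2 * n)) (Suc i)}
      \<longleftrightarrow> i \<in> Suc ` {i. bit n i \<and> bit n (Suc i)} \<union> (if odd n then {0} else {})"
      unfolding b by (cases i) (auto simp: bit_0)
  qed
  moreover have "0 \<notin> Suc ` {i. bit n i \<and> bit n (Suc i)}" by simp
  ultimately show ?thesis
    using finite_block11[of n] by (simp add: block11_count_def card_image)
qed

lemma GRS_double: "GRS (2 * n) = GRS n"
  and GRS_double_Suc: "GRS (Suc (2 * n)) = (-1) ^ n * GRS n"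
  by (simp_all add: GRS_eq_block11 block11_count_double block11_count_double_Suc)

definition GRS_sum :: "nat \<Rightarrow> complex \<Rightarrow> complex" where
  "GRS_sum m z = (\<Sum>n<m. of_int (GRS n) * z ^ n)"

text \<open>The sign \<open>(-1)\<^sup>n\<close> in the odd part is absorbed into the argument, so the odd half is again the same sum,
  evaluated at \<open>-z\<^sup>2\<close>.\<close>

lemma GRS_sum_double: "GRS_sum (2 * m) z = GRS_sum m (z\<^sup>2) + z * GRS_sum m (- z\<^sup>2)"
proof (induction m)
  case 0
  show ?case by (simp add: GRS_sum_def)
next
  case (Suc m)
  have "GRS_sum (2 * Suc m) z = GRS_sum (2 * m) z
      + of_int (GRS m) * (z\<^sup>2) ^ m + z * (of_int (GRS m) * (- z\<^sup>2) ^ m)"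
    by (simp add: GRS_sum_def GRS_double GRS_double_Suc power_mult power_minus[of "z\<^sup>2"])
  then show ?case by (simp add: Suc.IH, simp add: GRS_sum_def algebra_simps)
qed

lemma abs_GRS: "\<bar>GRS n\<bar> = 1"
  by (simp add: GRS_eq_block11 power_abs)

lemma cmod_GRS: "cmod (of_int (GRS n)) = 1"
  by (simp add: norm_of_int abs_GRS flip: of_int_abs)

lemma GRS_sum_quadruple:
  "GRS_sum (4 * m) z
    = (GRS_sum m (z ^ 4) + z\<^sup>2 * GRS_sum m (- (z ^ 4)))
      + z * (GRS_sum m (z ^ 4) - z\<^sup>2 * GRS_sum m (- (z ^ 4)))"
proof -
  have "4 * m = 2 * (2 * m)" by simp
  then show ?thesis
    by (simp only: GRS_sum_double) (simp flip: power_mult)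
qed

text \<open>Rotating \<open>y\<close> by \<open>cis (pi/16)\<close> changes the sign of \<open>y\<^sup>1\<^sup>6\<close>, so either \<open>y\<close> or its rotation
  satisfies the hypothesis \<open>Re (x\<^sup>1\<^sup>6) \<le> 0\<close> of the eight-point lemma.\<close>

lemma GRS_sum_not_flat_quadruple:
  assumes y: "cmod y = 1" and s: "s \<noteq> 0"
  shows "\<exists>j<32. \<not> near_unit (GRS_sum (4 * m) (cis (pi / 16) ^ j * y) / complex_of_real s)"
proof (rule ccontr)
  assume asm: "\<not> ?thesis"
  define w where "w = cis (pi / 16)"
  have w: "w ^ 8 = \<i>" by (simp add: w_def Complex.DeMoivre)
  have w4: "w ^ 12 = w ^ 4 * \<i>" "w ^ 16 = -1" "w ^ 20 = - (w ^ 4)" "w ^ 24 = - \<i>" "w ^ 28 = - (\<i> * w ^ 4)"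
    using power_add[of w 8 4] power_add[of w 8 8] power_add[of w 16 4] power_add[of w 16 8]
      power_add[of w 24 4] by (simp_all add: w)
  have cw: "cmod (w ^ n) = 1" for n by (simp add: w_def norm_power)
  \<comment> \<open>Only the exponents 0, 4, ..., 28 occur, so the bound 31 leaves room for one more rotation.\<close>
  have False if x: "cmod x = 1" "Re (x ^ 16) \<le> 0"
    and n: "\<And>j. j < 31 \<Longrightarrow> near_unit (GRS_sum (4 * m) (w ^ j * x) / complex_of_real s)" for x
  proof -
    define a where "a = GRS_sum m (x ^ 4) / complex_of_real s"
    define b where "b = GRS_sum m (- (x ^ 4)) / complex_of_real s"
    \<comment> \<open>The fourth power of \<open>u\<close> decides whether \<open>a\<close> and \<open>b\<close> keep their places or are exchanged.\<close>
    have eq1: "GRS_sum (4 * m) (u * x) / complex_of_real s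
        = (a + u\<^sup>2 * x\<^sup>2 * b) + u * x * (a - u\<^sup>2 * x\<^sup>2 * b)" if "u ^ 4 = 1" for u
      unfolding GRS_sum_quadruple a_def b_def using s that by (simp add: power_mult_distrib field_simps)
    have eq2: "GRS_sum (4 * m) (u * x) / complex_of_real s
        = (b + u\<^sup>2 * x\<^sup>2 * a) + u * x * (b - u\<^sup>2 * x\<^sup>2 * a)" if "u ^ 4 = -1" for u
      unfolding GRS_sum_quadruple a_def b_def using s that by (simp add: power_mult_distrib field_simps)
    have k: "(w ^ 4)\<^sup>2 = \<i>" "w ^ 16 = -1" "\<i> ^ 4 = 1" using w4 by (simp_all flip: power_mult add: w)
    have "near_flat4 x (a + x\<^sup>2 * b) (a - x\<^sup>2 * b)"
      using n[of 0] n[of 8] n[of 16] n[of 24] eq1[of 1] eq1[of "\<i>"] eq1[of "-1"] eq1[of "-\<i>"]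
      by (simp add: near_flat4_def w w4 k)
    moreover have "near_flat4 (w ^ 4 * x) (b + \<i> * x\<^sup>2 * a) (b - \<i> * x\<^sup>2 * a)"
      using n[of 4] n[of 12] n[of 20] n[of 28] eq2[of "w ^ 4"] eq2[of "w ^ 4 * \<i>"]
         eq2[of "-(w ^ 4)"] eq2[of "-(\<i> * w ^ 4)"]
      by (simp add: near_flat4_def w w4 k power_mult_distrib mult_ac flip: power_mult)
    ultimately show False using not_near_flat_at_eight_points[OF x(1) k(1) x(2)] by blast
  qed
  note * = this
  have y16: "(w * y) ^ 16 = - (y ^ 16)" by (simp add: power_mult_distrib w4)
  show False
  proof (cases "Re (y ^ 16) \<le> 0")
    case True
    then show False using *[OF y] asm by (auto simp: w_def)
  next
    case False
    have "cmod (w * y) = 1" using cw[of 1] y by (simp add: norm_mult)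
    moreover have "Re ((w * y) ^ 16) \<le> 0" unfolding y16 using False by simp
    moreover have "near_unit (GRS_sum (4 * m) (w ^ j * (w * y)) / complex_of_real s)" if "j < 31" for j
    proof -
      have "Suc j < 32" "w ^ j * (w * y) = w ^ Suc j * y" using that by simp_all
      then show ?thesis using asm by (metis w_def)
    qed
    ultimately show False by (rule *)
  qed
qed

text \<open>Cutting \<open>m\<close> down to a multiple of 4 removes at most three unimodular terms, so \<open>|S m| / s\<close> moves by at
  most \<open>3 / s \<le> 1/600\<close>; the tolerance 1/300 on the modulus keeps the squared modulus within 1/100.\<close>

lemma GRS_sum_not_flat:
  assumes y: "cmod y = 1" and s: "s \<ge> 1800"
  shows "\<exists>j<32. \<bar>cmod (GRS_sum m (cis (pi / 16) ^ j * y)) / s - 1\<bar> \<ge> 1 / 600"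
proof -
  define m' where "m' = 4 * (m div 4)"
  obtain j where j: "j < 32" "\<not> near_unit (GRS_sum m' (cis (pi / 16) ^ j * y) / complex_of_real s)"
    using GRS_sum_not_flat_quadruple[OF y, of s] s unfolding m'_def by auto
  define z where "z = cis (pi / 16) ^ j * y"
  have z: "cmod z = 1" by (simp add: z_def norm_mult norm_power y)
  have split: "{..<m} = {..<m'} \<union> {m'..<m}" unfolding m'_def by auto
  have "GRS_sum m z - GRS_sum m' z = (\<Sum>n=m'..<m. of_int (GRS n) * z ^ n)"
    unfolding GRS_sum_def split by (subst sum.union_disjoint) auto
  also have "cmod \<dots> \<le> (\<Sum>n=m'..<m. 1)"
    by (intro order_trans[OF norm_sum] sum_mono) (simp add: norm_mult norm_power z cmod_GRS del: norm_of_int)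
  also have "\<dots> \<le> real 3" unfolding m'_def by simp
  finally have "\<bar>cmod (GRS_sum m z) - cmod (GRS_sum m' z)\<bar> \<le> 3"
    using norm_triangle_ineq3[of "GRS_sum m z" "GRS_sum m' z"] by simp
  moreover define p q where "p = cmod (GRS_sum m z) / s" and "q = cmod (GRS_sum m' z) / s"
  ultimately have "\<bar>p - q\<bar> \<le> 3 / s"
    using s by (simp add: p_def q_def divide_right_mono flip: diff_divide_distrib)
  also have "3 / s \<le> 1 / 600" using s by (simp add: field_simps)
  finally have pq: "\<bar>p - q\<bar> \<le> 1/600" .
  have "\<bar>p - 1\<bar> \<ge> 1/600"
  proof (rule ccontr)
    assume "\<not> ?thesis"
    then have q: "\<bar>q - 1\<bar> < 1/300" using pq by linarith
    have "\<bar>q\<^sup>2 - 1\<bar> = \<bar>q - 1\<bar> * \<bar>q + 1\<bar>" by (simp add: power2_eq_square algebra_simps flip: abs_mult)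
    also have "\<dots> \<le> 1/300 * (5/2)"
    proof (rule mult_mono)
      show "\<bar>q + 1\<bar> \<le> 5/2" using q by linarith
    qed (use q in auto)
    finally have "near_unit (GRS_sum m' z / complex_of_real s)"
      using s by (simp add: near_unit_def q_def norm_divide)
    then show False using j z_def by simp
  qed
  then show ?thesis using j(1) by (auto simp: p_def z_def)
qed

section \<open>Rotation invariance and orthogonality on the circle\<close>

lemma sets_circle_measure: "sets circle_measure = sets (restrict_space borel (sphere 0 1))"
  and space_circle_measure: "space circle_measure = sphere 0 1"
  by (simp_all add: circle_measure_def space_restrict_space)

lemma finite_measure_circle_measure: "finite_measure circle_measure"
  by (rule finite_measureI) (simp add: space_circle_measure emeasure_circle_measure)

lemma measure_circle_measure: "measure circle_measure (space circle_measure) = 1"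
  by (simp add: measure_def space_circle_measure emeasure_circle_measure)

lemma continuous_measurable_circle:
  assumes "continuous_on (sphere 0 1) f"
  shows "f \<in> borel_measurable circle_measure"
  unfolding measurable_cong_sets[OF sets_circle_measure refl]
  using assms by (rule borel_measurable_continuous_on_restrict)

lemma integrable_circle_continuous:
  fixes f :: "complex \<Rightarrow> 'a::{banach, second_countable_topology}"
  assumes "continuous_on (sphere 0 1) f"
  shows "integrable circle_measure f"
proof -
  have "compact (f ` sphere 0 1)" using assms by (intro compact_continuous_image) auto
  then obtain b where "\<And>z. z \<in> sphere 0 1 \<Longrightarrow> norm (f z) \<le> b"
    using compact_imp_bounded bounded_iff by (metis imageI)
  then show ?thesis
    by (intro finite_measure.integrable_const_bound[OF finite_measure_circle_measure, of f b]
        AE_I2 continuous_measurable_circle assms) (simp add: space_circle_measure)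
qed

lemma mult_measurable_circle:
  assumes "cmod c = 1"
  shows "(*) c \<in> measurable circle_measure circle_measure"
  unfolding measurable_cong_sets[OF sets_circle_measure sets_circle_measure]
proof (rule measurable_restrict_space2)
  show "(*) c \<in> space (restrict_space borel (sphere 0 1)) \<rightarrow> sphere 0 1"
    using assms by (auto simp: space_restrict_space norm_mult)
  show "(*) c \<in> borel_measurable (restrict_space borel (sphere 0 1))"
    by (intro borel_measurable_continuous_on_restrict continuous_intros)
qed

text \<open>The half-open interval makes the parameter unique, so that a rotation can cut the interval and
  exchange its two pieces.\<close>

lemma emeasure_circle_measure_eq:
  assumes "A \<in> sets circle_measure"
  shows "emeasure circle_measure A = emeasure lborel ({0..<2 * pi} \<inter> cis -` A) / ennreal (2 * pi)"
    and "cis -` A \<in> sets borel"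
proof -
  have "cis -` A \<inter> space (uniform_measure lborel {0..2 * pi}) \<in> sets (uniform_measure lborel {0..2 * pi})"
    using cis_measurable_circle assms[unfolded sets_circle_measure] by (rule measurable_sets)
  then show B: "cis -` A \<in> sets borel" by simp
  have "emeasure circle_measure A = emeasure (uniform_measure lborel {0..2 * pi}) (cis -` A)"
    unfolding circle_measure_def
    using assms by (subst emeasure_distr[OF cis_measurable_circle]) (simp_all add: sets_circle_measure)
  also have "\<dots> = emeasure lborel ({0..2 * pi} \<inter> cis -` A) / ennreal (2 * pi)"
    using B by simp
  also have "emeasure lborel ({0..2 * pi} \<inter> cis -` A) = emeasure lborel ({0..<2 * pi} \<inter> cis -` A)"
  proof (rule emeasure_eq_AE)
    have "AE x in lborel. x \<noteq> 2 * pi" by (rule AE_lborel_singleton)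
    then show "AE x in lborel. x \<in> {0..2 * pi} \<inter> cis -` A \<longleftrightarrow> x \<in> {0..<2 * pi} \<inter> cis -` A"
      by eventually_elim auto
  qed (use B in auto)
  finally show "emeasure circle_measure A = emeasure lborel ({0..<2 * pi} \<inter> cis -` A) / ennreal (2 * pi)" .
qed

lemma emeasure_lborel_shift:
  fixes X :: "real set"
  assumes "X \<in> sets borel"
  shows "emeasure lborel X = emeasure lborel ((+) c -` X)"
proof -
  have "emeasure lborel X = emeasure (distr lborel borel ((+) c)) X" by (simp add: lborel_distr_plus)
  also have "\<dots> = emeasure lborel ((+) c -` X)" using assms by (subst emeasure_distr) auto
  finally show ?thesis .
qed

lemma emeasure_periodic_shift:
  fixes B :: "real set"
  assumes B: "B \<in> sets borel" and per: "\<And>t. p + t \<in> B \<longleftrightarrow> t \<in> B" and s: "0 \<le> s" "s < p"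
  shows "emeasure lborel ({0..<p} \<inter> ((+) s -` B)) = emeasure lborel ({0..<p} \<inter> B)"
proof -
  have "{0..<p} \<inter> ((+) s -` B) = (+) s -` ({s..<p + s} \<inter> B)" by auto
  then have "emeasure lborel ({0..<p} \<inter> ((+) s -` B)) = emeasure lborel ({s..<p + s} \<inter> B)"
    using emeasure_lborel_shift[of "{s..<p + s} \<inter> B" s] B by simp
  also have "{s..<p + s} \<inter> B = ({s..<p} \<inter> B) \<union> ({p..<p + s} \<inter> B)" using s by auto
  also have "emeasure lborel \<dots> = emeasure lborel ({s..<p} \<inter> B) + emeasure lborel ({p..<p + s} \<inter> B)"
    using B by (intro plus_emeasure[symmetric]) auto
  also have "emeasure lborel ({p..<p + s} \<inter> B) = emeasure lborel ({0..<s} \<inter> B)"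
  proof -
    have "(+) p -` ({p..<p + s} \<inter> B) = {0..<s} \<inter> B" by (auto simp: per)
    then show ?thesis using emeasure_lborel_shift[of "{p..<p + s} \<inter> B" p] B by simp
  qed
  also have "emeasure lborel ({s..<p} \<inter> B) + emeasure lborel ({0..<s} \<inter> B)
      = emeasure lborel (({s..<p} \<inter> B) \<union> ({0..<s} \<inter> B))"
    using B by (intro plus_emeasure) auto
  also have "({s..<p} \<inter> B) \<union> ({0..<s} \<inter> B) = {0..<p} \<inter> B" using s by auto
  finally show ?thesis .
qed

lemma distr_circle_rotate:
  assumes c: "cmod c = 1"
  shows "distr circle_measure circle_measure ((*) c) = circle_measure"
proof (rule measure_eqI)
  fix A assume "A \<in> sets (distr circle_measure circle_measure ((*) c))"
  then have A: "A \<in> sets circle_measure" by simp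
  define A' where "A' = (*) c -` A \<inter> space circle_measure"
  have A': "A' \<in> sets circle_measure"
    unfolding A'_def by (rule measurable_sets[OF mult_measurable_circle[OF c] A])
  define s where "s = Arg2pi c"
  have s: "c = cis s" "0 \<le> s" "s < 2 * pi"
    using Arg2pi_eq[of c] c Arg2pi_ge_0 Arg2pi_lt_2pi by (auto simp: s_def cis_conv_exp mult_ac)
  have "cis -` A' = (+) s -` (cis -` A)"
    by (auto simp: A'_def space_circle_measure s(1) cis_mult)
  moreover have "2 * pi + t \<in> cis -` A \<longleftrightarrow> t \<in> cis -` A" for t
    by (simp flip: cis_mult)
  ultimately have "emeasure lborel ({0..<2 * pi} \<inter> cis -` A') = emeasure lborel ({0..<2 * pi} \<inter> cis -` A)"
    using emeasure_periodic_shift[OF emeasure_circle_measure_eq(2)[OF A] _ s(2,3)] by simp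
  then have "emeasure circle_measure A' = emeasure circle_measure A"
    by (simp add: emeasure_circle_measure_eq A A')
  then show "emeasure (distr circle_measure circle_measure ((*) c)) A = emeasure circle_measure A"
    using A by (simp add: emeasure_distr mult_measurable_circle c A'_def)
qed simp

lemma integral_circle_rotate:
  fixes f :: "complex \<Rightarrow> 'a::{banach, second_countable_topology}"
  assumes "cmod c = 1" "f \<in> borel_measurable circle_measure"
  shows "(LINT z|circle_measure. f (c * z)) = (LINT z|circle_measure. f z)"
  using integral_distr[OF mult_measurable_circle[OF assms(1)] assms(2)]
  by (simp add: distr_circle_rotate assms(1))

lemma integrable_circle_rotate:
  fixes f :: "complex \<Rightarrow> 'a::{banach, second_countable_topology}"
  assumes "cmod c = 1" "integrable circle_measure f"
  shows "integrable circle_measure (\<lambda>z. f (c * z))"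
  using integrable_distr[OF mult_measurable_circle[OF assms(1)], of f] assms
  by (simp add: distr_circle_rotate)

text \<open>Rotation by \<open>cis (pi/n)\<close> changes the sign of the integrand.\<close>

lemma integral_circle_power:
  assumes "n > 0"
  shows "(LINT z|circle_measure. z ^ n) = 0"
proof -
  define c where "c = cis (pi / n)"
  have "c ^ n = -1" using assms by (simp add: c_def Complex.DeMoivre)
  then have "(LINT z|circle_measure. z ^ n) = (LINT z|circle_measure. - (z ^ n))"
    using integral_circle_rotate[of c "\<lambda>z. z ^ n"] 
    by (simp add: c_def continuous_measurable_circle continuous_intros power_mult_distrib)
  then show ?thesis by simp
qed

lemma integral_circle_orthonormal:
  "(LINT z|circle_measure. z ^ m * cnj (z ^ n)) = (if m = n then 1 else 0)"
proof -
  have red: "z ^ m * cnj (z ^ n) = z ^ (m - n)" if "n \<le> m" "z \<in> space circle_measure" for z m n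
  proof -
    have "z ^ m = z ^ (m - n) * z ^ n" using that by (simp flip: power_add)
    moreover have "z ^ n * cnj (z ^ n) = 1"
      using that by (simp only: complex_norm_square[symmetric]) (simp add: space_circle_measure norm_power)
    ultimately show ?thesis by (simp add: mult.assoc)
  qed
  have *: "(LINT z|circle_measure. z ^ m * cnj (z ^ n)) = (if m = n then 1 else 0)" if "n \<le> m" for m n
  proof -
    have "(LINT z|circle_measure. z ^ m * cnj (z ^ n)) = (LINT z|circle_measure. z ^ (m - n))"
      using red[OF that] by (intro Bochner_Integration.integral_cong) auto
    then show ?thesis using integral_circle_power[of "m - n"] that
      by (auto simp: measure_circle_measure)
  qed
  show ?thesis
  proof (cases "n \<le> m")
    case False
    have "(LINT z|circle_measure. z ^ m * cnj (z ^ n)) = (LINT z|circle_measure. cnj (z ^ n * cnj (z ^ m)))"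
      by (simp add: mult.commute)
    also have "\<dots> = cnj (LINT z|circle_measure. z ^ n * cnj (z ^ m))"
      by (rule Bochner_Integration.integral_cnj)
    finally have "(LINT z|circle_measure. z ^ m * cnj (z ^ n)) = cnj (LINT z|circle_measure. z ^ n * cnj (z ^ m))" .
    then show ?thesis using *[of m n] False by simp
  qed (rule *)
qed

lemma integral_circle_sum_norm_sq:
  assumes "finite F"
  shows "(LINT z|circle_measure. (cmod (\<Sum>n\<in>F. a n * z ^ n))\<^sup>2) = (\<Sum>n\<in>F. (cmod (a n))\<^sup>2)"
proof -
  have "complex_of_real (LINT z|circle_measure. (cmod (\<Sum>n\<in>F. a n * z ^ n))\<^sup>2)
      = (LINT z|circle_measure. (\<Sum>m\<in>F. \<Sum>n\<in>F. a m * cnj (a n) * (z ^ m * cnj (z ^ n))))"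
    by (simp flip: integral_complex_of_real of_real_power
        add: complex_norm_square sum_product mult_ac)
  also have "\<dots> = (\<Sum>m\<in>F. \<Sum>n\<in>F. a m * cnj (a n) * (LINT z|circle_measure. (z ^ m * cnj (z ^ n))))"
    by (subst Bochner_Integration.integral_sum integral_mult_right_zero 
       | intro integrable_circle_continuous continuous_intros sum.cong refl)+
  also have "\<dots> = (\<Sum>m\<in>F. a m * cnj (a m))"
    unfolding integral_circle_orthonormal using assms
    by (simp add: if_distrib[of "(*) _"] cong: if_cong)
  also have "\<dots> = complex_of_real (\<Sum>n\<in>F. (cmod (a n))\<^sup>2)"
    by (simp flip: of_real_power add: complex_norm_square)
  finally show ?thesis by (simp only: of_real_eq_iff)
qed

text \<open>The integral of \<open>g\<close> equals the integral of the mean of \<open>g\<close> over its \<open>k\<close> rotations, and one large value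
  among the rotations already makes that mean large.\<close>

lemma integral_circle_ge_of_rotations:
  fixes g :: "complex \<Rightarrow> real"
  assumes g: "continuous_on (sphere 0 1) g" "\<And>z. g z \<ge> 0" and c: "cmod c = 1"
    and ex: "\<And>z. cmod z = 1 \<Longrightarrow> \<exists>j<k::nat. g (c ^ j * z) \<ge> d"
  shows "d \<le> real k * (LINT z|circle_measure. g z)"
proof -
  have cj: "cmod (c ^ j) = 1" for j by (simp add: c norm_power)
  have int: "integrable circle_measure (\<lambda>z. g (c ^ j * z))" for j
    by (intro integrable_circle_rotate integrable_circle_continuous g cj)
  have "d = (LINT z|circle_measure. d)" by (simp add: measure_circle_measure)
  also have "\<dots> \<le> (LINT z|circle_measure. (\<Sum>j<k. g (c ^ j * z)))"
  proof (rule integral_mono)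
    show "integrable circle_measure (\<lambda>z. \<Sum>j<k. g (c ^ j * z))" by (intro Bochner_Integration.integrable_sum int)
    fix z assume "z \<in> space circle_measure"
    then obtain j where j: "j < k" "g (c ^ j * z) \<ge> d" using ex[of z] by (auto simp: space_circle_measure)
    then have "g (c ^ j * z) \<le> (\<Sum>j<k. g (c ^ j * z))" by (intro member_le_sum) (auto simp: g)
    then show "d \<le> (\<Sum>j<k. g (c ^ j * z))" using j by simp
  qed (intro integrable_circle_continuous continuous_intros)
  also have "\<dots> = (\<Sum>j<k. LINT z|circle_measure. g (c ^ j * z))"
    by (intro Bochner_Integration.integral_sum int)
  also have "\<dots> = real k * (LINT z|circle_measure. g z)"
    using integral_circle_rotate[OF cj continuous_measurable_circle[OF g(1)]] by simp
  finally show ?thesis .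
qed

section \<open>Integrability of the logarithm of a polynomial\<close>

lemma sin_ge_chord:
  fixes x :: real
  assumes "0 \<le> x" "x \<le> 1 / 2"
  shows "2 * x \<le> sin (pi * x)"
proof -
  have "concave_on {0..pi / 2} sin"
  proof (rule f''_le0_imp_concave)
    fix t :: real assume "t \<in> {0..pi / 2}"
    then show "- sin t \<le> 0" using sin_ge_zero[of t] pi_gt_zero by (auto simp: )
    show "(sin has_real_derivative cos t) (at t)" "(cos has_real_derivative - sin t) (at t)"
      by (auto intro!: derivative_eq_intros)
  qed simp
  from concave_onD[OF this, of "2 * x" 0 "pi / 2"] assms
  show ?thesis by (simp add: mult_ac)
qed

text \<open>The parabola vanishes at both ends of the interval to the same order as the sine; its shape is chosen
  to match the density of a Beta integral.\<close>

lemma sin_ge_parabola: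
  fixes x :: real
  assumes "0 \<le> x" "x \<le> 1"
  shows "2 * (x * (1 - x)) \<le> sin (pi * x)"
proof (cases "x \<le> 1 / 2")
  case True
  have "x * (1 - x) \<le> x * 1" using assms by (intro mult_left_mono) auto
  then show ?thesis using sin_ge_chord[of x] assms True by linarith
next
  case False
  have "x * (1 - x) \<le> 1 * (1 - x)" using assms by (intro mult_right_mono) auto
  moreover have "sin (pi * x) = sin (pi * (1 - x))" by (simp add: right_diff_distrib)
  ultimately show ?thesis using sin_ge_chord[of "1 - x"] assms False by linarith
qed

lemma cmod_cis_minus_one: "cmod (cis t - 1) = 2 * \<bar>sin (t / 2)\<bar>"
proof -
  have "(cmod (cis t - 1))\<^sup>2 = 2 - 2 * cos t"
    using sin_cos_squared_add[of t] unfolding cmod_power2 by (simp add: power2_eq_square algebra_simps)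
  also have "\<dots> = (2 * \<bar>sin (t / 2)\<bar>)\<^sup>2" using cos_double_sin[of "t / 2"] by (simp add: power_mult_distrib)
  finally show ?thesis by (rule power2_eq_imp_eq) auto
qed

lemma abs_ln_le:
  fixes x :: real
  assumes "0 < x" "x \<le> 2"
  shows "\<bar>ln x\<bar> \<le> 2 * x powr (-1/2)"
proof (cases "x \<le> 1")
  case True
  have "ln (x powr (-1/2)) \<le> x powr (-1/2) - 1" using assms by (intro ln_le_minus_one) auto
  then show ?thesis using assms True by (simp add: ln_powr abs_if)
next
  case False
  have "ln x \<le> x - 1" using assms by (intro ln_le_minus_one)
  also have "\<dots> \<le> 1" using assms by simp
  also have "1 \<le> 2 * x powr (-1/2)"
  proof -
    have "sqrt x \<le> sqrt 4" using assms by (intro real_sqrt_le_mono) auto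
    then have "sqrt x \<le> 2" by simp
    then show ?thesis using assms by (simp add: powr_minus_divide powr_half_sqrt field_simps)
  qed
  finally show ?thesis using False by simp
qed

lemma abs_ln_chord_le:
  fixes x :: real
  assumes "0 < x" "x < 1"
  shows "\<bar>ln (cmod (cis (2 * pi * x) - 1))\<bar> \<le> 2 * (x powr (1/2 - 1) * (1 - x) powr (1/2 - 1))"
proof -
  define r where "r = cmod (cis (2 * pi * x) - 1)"
  have "r = 2 * \<bar>sin (pi * x)\<bar>" by (simp add: r_def cmod_cis_minus_one mult.commute)
  then have r: "r \<le> 2" "x * (1 - x) \<le> r" 
    using sin_ge_parabola[of x] assms mult_pos_pos[of x "1 - x"] by (auto simp: abs_le_iff)
  have pos: "0 < x * (1 - x)" using assms by simp
  have "\<bar>ln r\<bar> \<le> 2 * r powr (-1/2)" using r pos by (intro abs_ln_le) auto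
  also have "\<dots> \<le> 2 * (x * (1 - x)) powr (-1/2)"
    using r pos by (intro mult_left_mono powr_mono2') auto
  finally show ?thesis using assms by (simp add: powr_mult r_def)
qed

text \<open>With \<open>t = 2 \<pi> x\<close>, the chord \<open>|cis t - 1| = 2 sin (\<pi> x)\<close> is at least \<open>x (1 - x)\<close>, and \<open>|ln r|\<close> is at most
  \<open>2 / sqrt r\<close> for \<open>r \<le> 2\<close>; so the convergent integral for \<open>Beta (1/2) (1/2)\<close> dominates.\<close>

lemma integrable_circle_ln_minus_one: "integrable circle_measure (\<lambda>z. ln (cmod (z - 1)))"
proof -
  define f where "f = (\<lambda>t. ln (cmod (cis t - 1)))"
  have f[measurable]: "f \<in> borel_measurable borel"
    unfolding f_def by (intro borel_measurable_ln borel_measurable_continuous_onI continuous_intros)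
  have "integrable lborel (\<lambda>x. indicator {0..1} x * f (0 + 2 * pi * x))"
  proof (rule Bochner_Integration.integrable_bound)
    show "integrable lborel (\<lambda>x. 2 * (indicator {0..1} x *\<^sub>R ((x::real) powr (1/2 - 1) * (1 - x) powr (1/2 - 1))))"
      using integrable_Beta[of "1/2" "1/2"] unfolding set_integrable_def by (intro integrable_mult_right) simp
    have "AE x in lborel. (x::real) \<noteq> 0" "AE x in lborel. (x::real) \<noteq> 1" by (rule AE_lborel_singleton)+
    then show "AE x in lborel. norm (indicator {0..1} x * f (0 + 2 * pi * x))
        \<le> norm (2 * (indicator {0..1} x *\<^sub>R ((x::real) powr (1/2 - 1) * (1 - x) powr (1/2 - 1))))"
    proof eventually_elim
      case (elim x)
      then show ?case using abs_ln_chord_le[of x]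
        by (cases "x \<in> {0..1}") (auto simp: f_def abs_mult)
    qed
  qed simp
  moreover have "indicator {0..1} x = (indicator {0..2 * pi} (0 + 2 * pi * x) :: real)" for x
    by (auto simp: indicator_def zero_le_mult_iff) (use pi_gt_zero in linarith)+
  ultimately have "integrable lborel (\<lambda>x. indicator {0..2 * pi} (0 + 2 * pi * x) * f (0 + 2 * pi * x))"
    by simp
  then have "integrable lborel (\<lambda>x. indicator {0..2 * pi} x * f x)"
    using lborel_integrable_real_affine_iff[of "2 * pi" "\<lambda>x. indicator {0..2 * pi} x * f x" 0] by simp
  then have "integrable lborel (\<lambda>x. (indicator {0..2 * pi} x / (2 * pi)) *\<^sub>R f x)"
    by (simp add: integrable_divide)
  then have "integrable (density lborel (\<lambda>x. ennreal (indicator {0..2 * pi} x / (2 * pi)))) f"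
    by (subst integrable_density) (use pi_gt_zero in auto)
  moreover have "uniform_measure lborel {0..2 * pi}
      = density lborel (\<lambda>x. ennreal (indicator {0..2 * pi} x / (2 * pi)))"
    unfolding uniform_measure_def using pi_gt_zero
    by (intro density_cong) (auto simp: indicator_def divide_ennreal simp flip: ennreal_1)
  ultimately have "integrable (uniform_measure lborel {0..2 * pi}) f" by simp
  moreover have "(\<lambda>z. ln (cmod (z - 1))) \<in> borel_measurable (restrict_space borel (sphere 0 1))"
    by (intro borel_measurable_ln borel_measurable_continuous_on_restrict continuous_intros)
  ultimately show ?thesis
    unfolding circle_measure_def f_def by (subst integrable_distr_eq[OF cis_measurable_circle])
qed

lemma integrable_circle_ln_minus: "integrable circle_measure (\<lambda>z. ln (cmod (z - a)))"
proof (cases "cmod a = 1")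
  case True
  have "cmod (z - a) = cmod (inverse a * z - 1)" for z
  proof -
    have "z - a = a * (inverse a * z - 1)" using True by (cases "a = 0") (auto simp: field_simps)
    then have "cmod (z - a) = cmod (a * (inverse a * z - 1))" by simp
    then show ?thesis using True by (simp only: norm_mult mult_1)
  qed
  then show ?thesis
    using integrable_circle_rotate[OF _ integrable_circle_ln_minus_one, of "inverse a"] True
    by (simp add: norm_inverse)
next
  case False
  then show ?thesis by (intro integrable_circle_continuous continuous_intros) auto
qed

lemma AE_circle_neq: "AE z in circle_measure. z \<noteq> a"
proof (cases "cmod a = 1")
  case True
  have a: "{a} \<in> sets circle_measure"
    using True by (simp add: sets_circle_measure sets_restrict_space_iff)
  have "{0..<2 * pi} \<inter> cis -` {a} \<subseteq> {Arg2pi a}"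
    using Arg2pi_unique[of 1 _ a] by (auto simp: cis_conv_exp)
  then have "{0..<2 * pi} \<inter> cis -` {a} \<in> null_sets lborel"
    by (intro finite_imp_null_set_lborel) (rule finite_subset, auto)
  then have "{a} \<in> null_sets circle_measure"
    using a by (auto simp: null_sets_def emeasure_circle_measure_eq(1)[OF a])
  then show ?thesis using AE_not_in by fastforce
next
  case False
  then show ?thesis by (intro AE_I2) (auto simp: space_circle_measure)
qed

lemma AE_circle_poly_nonzero:
  assumes "p \<noteq> 0" shows "AE z in circle_measure. poly p z \<noteq> 0"
proof -
  have "AE z in circle_measure. \<forall>a\<in>{a. poly p a = 0}. z \<noteq> a"
    using poly_roots_finite[OF assms] AE_circle_neq by (intro AE_finite_allI)
  then show ?thesis by eventually_elim auto
qed

text \<open>Splitting off one linear factor at a time turns the logarithm of the modulus into a sum of terms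
  \<open>ln |z - a|\<close>. Zeros on the circle, where \<open>ln 0 = 0\<close> breaks additivity, form a null set.\<close>

lemma integrable_circle_ln_poly:
  assumes "p \<noteq> 0"
  shows "integrable circle_measure (\<lambda>z. ln (cmod (poly p z)))"
  using assms
proof (induction "degree p" arbitrary: p)
  case 0
  then obtain c where "p = [:c:]" using degree_eq_zeroE by metis
  then show ?case by (simp add: integrable_circle_continuous)
next
  case (Suc n)
  then have "\<not> constant (poly p)" by (simp add: constant_degree)
  then obtain a where "poly p a = 0" using fundamental_theorem_of_algebra by blast
  then obtain q where q: "p = [:-a, 1:] * q" using poly_eq_0_iff_dvd by (metis dvdE)
  then have q0: "q \<noteq> 0" using Suc.prems by auto
  have "degree p = degree [:-a, 1:] + degree q"
    unfolding q using q0 by (intro degree_mult_eq) auto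
  then have "degree q = n" using Suc.hyps(2) by simp
  then have "integrable circle_measure (\<lambda>z. ln (cmod (z - a)) + ln (cmod (poly q z)))"
    using q0 Suc.hyps(1) by (intro Bochner_Integration.integrable_add integrable_circle_ln_minus) auto
  moreover have "AE z in circle_measure. ln (cmod (z - a)) + ln (cmod (poly q z)) = ln (cmod (poly p z))"
    using AE_circle_neq[of a] AE_circle_poly_nonzero[OF q0]
  proof eventually_elim
    case (elim z)
    have "cmod (poly p z) = cmod (z - a) * cmod (poly q z)" by (simp add: q norm_mult[symmetric] algebra_simps)
    then show ?case using elim by (simp add: ln_mult_pos)
  qed
  moreover have "(\<lambda>z. ln (cmod (poly p z))) \<in> borel_measurable circle_measure"
    by (intro borel_measurable_ln continuous_measurable_circle continuous_intros)
  ultimately show ?case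
    using integrable_cong_AE_imp by (metis (mono_tags, lifting) AE_cong)
qed

section \<open>Norms of the normalized sums\<close>

lemma poly_GRS_poly: "poly (GRS_poly N) z = GRS_sum (Suc N) z"
  by (simp add: GRS_poly_def GRS_sum_def poly_sum poly_monom lessThan_Suc_atMost)

lemma GRS_poly_nonzero: "GRS_poly N \<noteq> 0"
proof
  assume "GRS_poly N = 0"
  then have "poly (GRS_poly N) 0 = 0" by simp
  moreover have "poly (GRS_poly N) 0 = of_int (GRS 0)"
    unfolding poly_GRS_poly GRS_sum_def by (subst sum.lessThan_Suc_shift) simp
  ultimately show False using abs_GRS[of 0] by simp
qed

lemma circle_norm_GRS_poly: "circle_norm 2 (poly (GRS_poly N)) = sqrt (N + 1)"
proof -
  have "(LINT z|circle_measure. cmod (poly (GRS_poly N) z) powr 2) = (\<Sum>n<Suc N. (cmod (of_int (GRS n)))\<^sup>2)"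
    by (simp only: powr_numeral norm_ge_zero poly_GRS_poly GRS_sum_def integral_circle_sum_norm_sq finite_lessThan)
  also have "\<dots> = N + 1" by (simp only: cmod_GRS) simp
  finally show ?thesis by (simp add: circle_norm_def powr_half_sqrt)
qed

lemma GRS_normalized_eq: "GRS_normalized N z = GRS_sum (Suc N) z / complex_of_real (sqrt (N + 1))"
  by (simp only: GRS_normalized_def circle_norm_GRS_poly poly_GRS_poly)

lemma continuous_GRS_normalized [continuous_intros]:
  "continuous_on A (GRS_normalized N)"
  unfolding GRS_normalized_eq[abs_def] GRS_sum_def by (intro continuous_intros) simp

lemma integral_GRS_normalized_sq: "(LINT z|circle_measure. (cmod (GRS_normalized N z))\<^sup>2) = 1"
proof -
  have "(LINT z|circle_measure. (cmod (GRS_normalized N z))\<^sup>2)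
      = (LINT z|circle_measure. (cmod (GRS_sum (Suc N) z))\<^sup>2 / (N + 1))"
    by (simp add: GRS_normalized_eq norm_divide power_divide add_nonneg_nonneg)
  also have "\<dots> = (\<Sum>n<Suc N. (cmod (of_int (GRS n)))\<^sup>2) / (N + 1)"
    by (simp only: integral_divide_zero GRS_sum_def integral_circle_sum_norm_sq finite_lessThan)
  also have "\<dots> = 1" by (simp only: cmod_GRS) simp
  finally show ?thesis .
qed

text \<open>The size of \<open>N\<close> ensures that the \<open>L\<^sup>2\<close> norm of the unnormalized sum is at least 1800.\<close>

lemma GRS_normalized_deviation:
  assumes "\<alpha> > 0" "N \<ge> 1800\<^sup>2"
  shows "(1 / 600) powr \<alpha> / 32 \<le> (LINT z|circle_measure. \<bar>cmod (GRS_normalized N z) - 1\<bar> powr \<alpha>)"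
proof -
  have "(1 / 600) powr \<alpha> \<le> real 32 * (LINT z|circle_measure. \<bar>cmod (GRS_normalized N z) - 1\<bar> powr \<alpha>)"
  proof (rule integral_circle_ge_of_rotations)
    show "continuous_on (sphere 0 1) (\<lambda>z. \<bar>cmod (GRS_normalized N z) - 1\<bar> powr \<alpha>)"
      using assms(1) by (intro continuous_on_powr' continuous_intros) auto
    show "cmod (cis (pi / 16)) = 1" by simp
    fix z :: complex assume z: "cmod z = 1"
    have "1800 \<le> sqrt (N + 1)" using assms(2) by (intro real_le_rsqrt) (simp flip: of_nat_power)
    from GRS_sum_not_flat[OF z this, of "Suc N"]
    obtain j where j: "j < 32" "1 / 600 \<le> \<bar>cmod (GRS_normalized N (cis (pi / 16) ^ j * z)) - 1\<bar>"
      by (auto simp: GRS_normalized_eq norm_divide)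
    then have "(1 / 600) powr \<alpha> \<le> \<bar>cmod (GRS_normalized N (cis (pi / 16) ^ j * z)) - 1\<bar> powr \<alpha>"
      using assms(1) by (intro powr_mono2) auto
    then show "\<exists>j<32. (1 / 600) powr \<alpha> \<le> \<bar>cmod (GRS_normalized N (cis (pi / 16) ^ j * z)) - 1\<bar> powr \<alpha>"
      using j(1) by blast
  qed simp
  then show ?thesis by simp
qed

text \<open>Half of the lower bound for the integral of \<open>(|p\<^sub>N| - 1)\<^sup>2\<close>: a deviation 1/600 at one of 32 points.\<close>

definition flatness_gap :: real where "flatness_gap = 1 / (2 * 32 * 600\<^sup>2)"

text \<open>Since \<open>p\<^sub>N\<close> has \<open>L\<^sup>2\<close> norm 1, the squared \<open>L\<^sup>2\<close> distance of \<open>|p\<^sub>N|\<close> from 1 is \<open>2 - 2 \<parallel>p\<^sub>N\<parallel>\<^sub>1\<close>.\<close>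

lemma GRS_normalized_L1:
  assumes "N \<ge> 1800\<^sup>2"
  shows "(LINT z|circle_measure. cmod (GRS_normalized N z)) \<le> 1 - flatness_gap"
proof -
  have int: "integrable circle_measure (\<lambda>z. cmod (GRS_normalized N z))"
    "integrable circle_measure (\<lambda>z. (cmod (GRS_normalized N z))\<^sup>2)"
    "integrable circle_measure (\<lambda>z. 1::real)"
    by (intro integrable_circle_continuous continuous_intros)+
  have "2 * flatness_gap = (1 / 600) powr 2 / 32" by (simp add: flatness_gap_def power2_eq_square)
  also have "\<dots> \<le> (LINT z|circle_measure. \<bar>cmod (GRS_normalized N z) - 1\<bar> powr 2)"
    using assms by (intro GRS_normalized_deviation) auto
  also have "\<dots> = (LINT z|circle_measure. (cmod (GRS_normalized N z))\<^sup>2 - 2 * cmod (GRS_normalized N z) + 1)"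
    by (simp add: power2_diff algebra_simps)
  also have "\<dots> = 2 - 2 * (LINT z|circle_measure. cmod (GRS_normalized N z))"
    using int by (simp add: integral_GRS_normalized_sq measure_circle_measure)
  finally show ?thesis by simp
qed

lemma integrable_ln_GRS_normalized:
  "integrable circle_measure (\<lambda>z. ln (cmod (GRS_normalized N z)))"
proof -
  define p where "p = smult (1 / complex_of_real (sqrt (N + 1))) (GRS_poly N)"
  have "poly p = GRS_normalized N"
    by (simp add: p_def fun_eq_iff GRS_normalized_eq poly_GRS_poly)
  moreover have "p \<noteq> 0"
    using GRS_poly_nonzero by (simp add: p_def flip: of_nat_Suc)
  ultimately show ?thesis using integrable_circle_ln_poly[of p] by simp
qed

text \<open>This is the inequality \<open>ln x \<le> x - 1\<close> under the integral. It fails at zeros of \<open>f\<close> because of the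
  convention \<open>ln 0 = 0\<close>, hence the hypothesis that they are negligible.\<close>

lemma Mahler_le_exp:
  assumes "integrable circle_measure (\<lambda>z. ln (cmod (f z)))" "continuous_on (sphere 0 1) f"
    and nz: "AE z in circle_measure. f z \<noteq> 0"
  shows "Mahler f \<le> exp ((LINT z|circle_measure. cmod (f z)) - 1)"
proof -
  have int: "integrable circle_measure (\<lambda>z. cmod (f z))" "integrable circle_measure (\<lambda>z. 1 :: real)"
    by (intro integrable_circle_continuous continuous_intros assms)+
  have "(LINT z|circle_measure. ln (cmod (f z))) \<le> (LINT z|circle_measure. cmod (f z) - 1)"
  proof (intro integral_mono_AE assms Bochner_Integration.integrable_diff int)
    show "AE z in circle_measure. ln (cmod (f z)) \<le> cmod (f z) - 1"
      using nz by eventually_elim (simp add: ln_le_minus_one)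
  qed
  also have "\<dots> = (LINT z|circle_measure. cmod (f z)) - 1"
    using int by (simp add: measure_circle_measure)
  finally show ?thesis by (simp add: Mahler_def)
qed

theorem mainTheorem2:
  shows "limsup (\<lambda>N. ereal (circle_norm 1 (GRS_normalized N))) < 1
    \<and> (\<forall>\<alpha>::real. \<alpha> \<ge> 0 \<longrightarrow> \<not> L_flat \<alpha> GRS_normalized)"
proof (intro conjI allI impI)
  have gap: "flatness_gap > 0" by (simp add: flatness_gap_def)
  have large: "eventually (\<lambda>N. N \<ge> (1800\<^sup>2 :: nat)) sequentially" by (rule eventually_ge_at_top)
  have norm1: "circle_norm 1 f = (LINT z|circle_measure. cmod (f z))" for f
    by (simp add: circle_norm_def integral_nonneg_AE)
  have "limsup (\<lambda>N. ereal (circle_norm 1 (GRS_normalized N))) \<le> ereal (1 - flatness_gap)"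
    by (rule Limsup_bounded, rule eventually_mono[OF large]) (simp only: norm1 ereal_less_eq GRS_normalized_L1)
  also have "\<dots> < 1" using gap by simp
  finally show "limsup (\<lambda>N. ereal (circle_norm 1 (GRS_normalized N))) < 1" .

  fix \<alpha> :: real assume \<alpha>: "\<alpha> \<ge> 0"
  show "\<not> L_flat \<alpha> GRS_normalized"
  proof (cases "\<alpha> = 0")
    case True
    have "Mahler (GRS_normalized N) \<le> exp (- flatness_gap)" if "N \<ge> 1800\<^sup>2" for N
    proof -
      have "AE z in circle_measure. GRS_normalized N z \<noteq> 0"
        using AE_circle_poly_nonzero[OF GRS_poly_nonzero[of N]]
        by eventually_elim (simp add: GRS_normalized_eq poly_GRS_poly flip: of_nat_Suc)
      then have "Mahler (GRS_normalized N) \<le> exp ((LINT z|circle_measure. cmod (GRS_normalized N z)) - 1)"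
        by (intro Mahler_le_exp integrable_ln_GRS_normalized continuous_GRS_normalized)
      also have "\<dots> \<le> exp (- flatness_gap)" using GRS_normalized_L1[OF that] by simp
      finally show ?thesis .
    qed
    note bound = this
    have ev: "\<forall>\<^sub>F N in sequentially. Mahler (GRS_normalized N) \<le> exp (- flatness_gap)"
      by (rule eventually_mono[OF large]) (rule bound)
    show ?thesis
    proof
      assume "L_flat \<alpha> GRS_normalized"
      then have "(\<lambda>N. Mahler (GRS_normalized N)) \<longlonglongrightarrow> 1" using True by (simp add: L_flat_def)
      then have "1 \<le> exp (- flatness_gap)" using ev by (rule tendsto_upperbound) simp
      then show False using gap by simp
    qed
  next
    case False
    define d where "d = ((1 / 600) powr \<alpha> / 32) powr (1 / \<alpha>)"
    have "d \<le> circle_norm \<alpha> (\<lambda>z. complex_of_real (cmod (GRS_normalized N z) - 1))" if "N \<ge> 1800\<^sup>2" for N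
      unfolding d_def circle_norm_def norm_of_real
      using GRS_normalized_deviation[of \<alpha>, OF _ that] \<alpha> False by (simp add: powr_mono2)
    note bound = this
    have ev: "\<forall>\<^sub>F N in sequentially. d \<le> circle_norm \<alpha> (\<lambda>z. complex_of_real (cmod (GRS_normalized N z) - 1))"
      by (rule eventually_mono[OF large]) (rule bound)
    have "d > 0" by (simp add: d_def)
    show ?thesis
    proof
      assume "L_flat \<alpha> GRS_normalized"
      then have "(\<lambda>N. circle_norm \<alpha> (\<lambda>z. complex_of_real (cmod (GRS_normalized N z) - 1))) \<longlonglongrightarrow> 0"
        using False by (simp add: L_flat_def)
      then have "d \<le> 0" using ev by (rule tendsto_lowerbound) simp
      then show False using \<open>d > 0\<close> by simp
    qed
  qed
qed

end
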